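(* For every integer $n\ge 2$, the dimension of the best--worst choice polytope $\mathbf{BW}_n$ on $n$ alternatives is $$\dim \mathbf{BW}_n = n(n-3)2^{n-2}+\binom{n}{2}-\binom{n}{3}+n .$$
   Context: Let $[n]=\{1,\dots,n\}$ and let $\Pi_n$ be the set of all rankings (total orders) of $[n]$, written as words $\pi=(\pi_1,\dots,\pi_n)$ in which every element of $[n]$ occurs exactly once; $\pi_1$ is the best and $\pi_n$ the worst element. For $B\subseteq[n]$, the restriction $\pi|_B$ is the ranking of $B$ induced by $\pi$; its first entry is the best element of $B$ under $\pi$ and its last entry is the worst element of $B$ under $\pi$. Let $\Theta_n=\{(a,b,B): B\subseteq[n],\ |B|\ge 2,\ a,b\in B,\ a\ne b\}$. For $\pi\in\Pi_n$ let $v_\pi\in\mathbb{R}^{\Theta_n}$ be the 0/1 vector whose $(a,b,B)$-coordinate is $1$ if $a$ is the best element of $B$ under $\pi$ and $b$ is the worst element of $B$ under $\pi$, and $0$ otherwise. The best--worst choice polytope is $\mathbf{BW}_n=\operatorname{conv}\{v_\pi:\pi\in\Pi_n\}\subseteq\mathbb{R}^{\Theta_n}$. The dimension of a polytope is the dimension of its affine hull. (For $n=2$, $\binom{n}{3}=0$.) *)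

theory Defs
  imports "HOL-Analysis.Analysis"
begin

text \<open>
  The set of alternatives \<open>[n]\<close> is an arbitrary finite type \<open>'n\<close> with \<open>n = CARD('n)\<close>.
\<close>

definition rankings :: "'n::finite list set" where
  "rankings = {\<pi>. distinct \<pi> \<and> set \<pi> = UNIV}"

definition restriction :: "'n list \<Rightarrow> 'n set \<Rightarrow> 'n list" where
  "restriction \<pi> B = filter (\<lambda>x. x \<in> B) \<pi>"

definition best :: "'n list \<Rightarrow> 'n set \<Rightarrow> 'n" where
  "best \<pi> B = hd (restriction \<pi> B)"

definition worst :: "'n list \<Rightarrow> 'n set \<Rightarrow> 'n" where
  "worst \<pi> B = last (restriction \<pi> B)"

definition Theta :: "('n::finite \<times> 'n \<times> 'n set) set" where
  "Theta = {(a, b, B). card B \<ge> 2 \<and> a \<in> B \<and> b \<in> B \<and> a \<noteq> b}"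

text \<open>
  The space of real vectors indexed by \<open>Theta\<close> is realised as the coordinate subspace of
  \<open>real ^ ('n \<times> 'n \<times> 'n set)\<close> whose coordinates outside \<open>Theta\<close> vanish.  Deleting these
  coordinates is a linear isomorphism on that subspace, so the dimension is not affected.
\<close>

definition vertex :: "'n::finite list \<Rightarrow> real ^ ('n \<times> 'n \<times> 'n set)" where
  "vertex \<pi> = (\<chi> t. case t of (a, b, B) \<Rightarrow>
     if (a, b, B) \<in> Theta \<and> a = best \<pi> B \<and> b = worst \<pi> B then 1 else 0)"

definition BW :: "(real ^ ('n::finite \<times> 'n \<times> 'n set)) set" where
  "BW = convex hull (vertex ` rankings)"

end

theory Submission
  imports Defs "HOL-Library.Multiset"
begin

text \<open>
  Split the coordinates \<open>(a, b, B)\<close> into levels \<open>B\<close>. Modulo the coordinates on proper subsets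
  of \<open>B\<close>, a difference of vertices, read on level \<open>B\<close> as a matrix indexed by pairs, has
  total sum 0, and each column sum is \<open>(- 1) ^ (card B - 1)\<close> times the matching row sum, since
  inclusion-exclusion expresses ``\<open>w\<close> is worst in \<open>B\<close>'' through ``\<open>w\<close> is best
  in \<open>C\<close>'' for \<open>w \<in> C \<subseteq> B\<close>. On levels of size 3 there is one more relation.
  So on a level of size \<open>k\<close>, at most 1, 2 or \<open>k (k - 2)\<close> coordinates are free, for
  \<open>k = 2\<close>, \<open>k = 3\<close> and \<open>k \<ge> 4\<close> respectively.

  Conversely, suppose that a combination of these free coordinates is constant on the vertices, and
  let \<open>B\<close> be a maximal level on which it has nonzero coefficients. A signed sum of words
  over \<open>B\<close> that is a product of iterated commutators vanishes once any letter is deleted, so it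
  kills every function of a restriction to a set not containing \<open>B\<close>; only the level-\<open>B\<close> part
  of the combination survives. Enough such products exist to force its coefficients to vanish.
\<close>

section \<open>Iterated commutators of words\<close>

text \<open>
  A formal linear combination of words is represented by the functional it induces on functions of
  words; \<open>bracket\<close> is the right-nested commutator \<open>[x\<^sub>1, [x\<^sub>2, [\<dots>, x\<^sub>m]]]\<close>.
\<close>

fun bracket :: "'a list \<Rightarrow> ('a list \<Rightarrow> real) \<Rightarrow> real" where
  "bracket [] h = h []"
| "bracket [x] h = h [x]"
| "bracket (x # y # ys) h =
    bracket (y # ys) (\<lambda>v. h (x # v)) - bracket (y # ys) (\<lambda>v. h (v @ [x]))"

lemma bracket_Cons:
  "xs \<noteq> [] \<Longrightarrow> bracket (x # xs) h = bracket xs (\<lambda>v. h (x # v)) - bracket xs (\<lambda>v. h (v @ [x]))"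
  by (cases xs) auto

lemma bracket_add: "bracket xs (\<lambda>w. f w + g w) = bracket xs f + bracket xs g"
  by (induction xs arbitrary: f g rule: induct_list012) auto

lemma bracket_cong:
  "(\<And>w. mset w = mset xs \<Longrightarrow> f w = g w) \<Longrightarrow> bracket xs f = bracket xs g"
proof (induction xs arbitrary: f g rule: induct_list012)
  case (3 x y zs)
  have "bracket (y # zs) (\<lambda>v. f (x # v)) = bracket (y # zs) (\<lambda>v. g (x # v))"
    by (rule "3.IH"(2), rule "3.prems") simp
  moreover have "bracket (y # zs) (\<lambda>v. f (v @ [x])) = bracket (y # zs) (\<lambda>v. g (v @ [x]))"
    by (rule "3.IH"(2), rule "3.prems") simp
  ultimately show ?case by simp
qed auto

lemma bracket_cong_nonempty:
  assumes "\<And>w. w \<noteq> [] \<Longrightarrow> f w = g w" "xs \<noteq> []"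
  shows "bracket xs f = bracket xs g"
  by (rule bracket_cong) (metis assms mset_zero_iff)

text \<open>If the outer letter is deleted, \<open>x # v\<close> and \<open>v @ [x]\<close> become
  the same word and the two terms cancel. If it survives, a letter of the inner part is deleted:
  induction applies, or both terms shrink to \<open>[x]\<close> when the inner part is a single
  letter.\<close>

lemma bracket_filter:
  assumes "length xs \<ge> 2" "\<not> set xs \<subseteq> D"
  shows "bracket xs (\<lambda>w. h (filter (\<lambda>x. x \<in> D) w)) = 0"
  using assms
proof (induction xs arbitrary: h rule: induct_list012)
  case (3 x y zs)
  show ?case
  proof (cases "x \<in> D")
    case True
    show ?thesis
    proof (cases zs)
      case Nil
      then show ?thesis using 3 True by auto
    next
      case (Cons u us)
      then have l: "length (y # zs) \<ge> 2" by simp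
      have s: "\<not> set (y # zs) \<subseteq> D" using "3.prems" True by simp
      show ?thesis
        using "3.IH"(2)[OF l s, of "\<lambda>u. h (x # u)"] "3.IH"(2)[OF l s, of "\<lambda>u. h (u @ [x])"] True
        by simp
    qed
  qed simp
qed auto

lemma bracket_const:
  assumes "length xs \<ge> 2"
  shows "bracket xs (\<lambda>_. k) = 0"
  using bracket_filter[of xs "{}" "\<lambda>_. k"] assms by (cases xs) auto

text \<open>In an outer commutator the term \<open>y # v\<close> shows the constant head
  \<open>y\<close>, which the inner commutator kills; only the negative term \<open>v @ [y]\<close>
  keeps the inner head, hence one sign per letter of \<open>ys\<close>. For last letters the roles
  swap and no sign arises.\<close>

lemma bracket_hd:
  "bracket (ys @ [c, d]) (\<lambda>w. \<phi> (hd w)) = (- 1) ^ length ys * (\<phi> c - \<phi> d)"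
proof (induction ys)
  case (Cons y ys)
  have "bracket (ys @ [c, d]) (\<lambda>v. \<phi> (hd (v @ [y]))) = bracket (ys @ [c, d]) (\<lambda>v. \<phi> (hd v))"
    by (rule bracket_cong_nonempty) auto
  then show ?case using Cons by (simp add: bracket_Cons bracket_const)
qed simp

lemma bracket_last:
  "bracket (ys @ [c, d]) (\<lambda>w. \<phi> (last w)) = \<phi> d - \<phi> c"
proof (induction ys)
  case (Cons y ys)
  have "bracket (ys @ [c, d]) (\<lambda>v. \<phi> (last (y # v))) = bracket (ys @ [c, d]) (\<lambda>v. \<phi> (last v))"
    by (rule bracket_cong_nonempty) auto
  then show ?case using Cons by (simp add: bracket_Cons bracket_const)
qed simp

text \<open>\<open>\<mu>\<close> stands for a signed sum of rankings of \<open>B\<close>: the second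
  clause confines it to words listing \<open>B\<close> without repetition, the third says that the
  sum collapses to zero once letters are deleted.\<close>

definition restriction_annihilator :: "'a set \<Rightarrow> (('a list \<Rightarrow> real) \<Rightarrow> real) \<Rightarrow> bool" where
  "restriction_annihilator B \<mu> \<longleftrightarrow>
    (\<forall>f g. \<mu> (\<lambda>w. f w + g w) = \<mu> f + \<mu> g) \<and>
    (\<forall>f g. (\<forall>w. distinct w \<and> set w = B \<longrightarrow> f w = g w) \<longrightarrow> \<mu> f = \<mu> g) \<and>
    (\<forall>D h. \<not> B \<subseteq> D \<longrightarrow> \<mu> (\<lambda>w. h (restriction w D)) = 0)"

lemma restriction_annihilator_bracket:
  assumes "distinct xs" "length xs \<ge> 2"
  shows "restriction_annihilator (set xs) (bracket xs)"
  unfolding restriction_annihilator_def restriction_def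
proof (intro conjI allI impI)
  fix f g :: "'a list \<Rightarrow> real"
  assume fg: "\<forall>w. distinct w \<and> set w = set xs \<longrightarrow> f w = g w"
  show "bracket xs f = bracket xs g"
  proof (rule bracket_cong)
    fix w assume w: "mset w = mset xs"
    show "f w = g w"
      using fg mset_eq_setD[OF w] mset_eq_imp_distinct_iff[OF w] assms(1) by blast
  qed
qed (use assms in \<open>auto simp: bracket_add intro: bracket_filter\<close>)

text \<open>The composite functional is the concatenation product of the two combinations of words.\<close>

lemma restriction_annihilator_mult:
  assumes "restriction_annihilator A \<mu>" "restriction_annihilator B \<nu>" "A \<inter> B = {}"
  shows "restriction_annihilator (A \<union> B) (\<lambda>h. \<mu> (\<lambda>u. \<nu> (\<lambda>v. h (u @ v))))"
proof -
  have \<mu>: "\<And>f g. \<mu> (\<lambda>w. f w + g w) = \<mu> f + \<mu> g"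
    "\<And>f g. (\<And>w. distinct w \<Longrightarrow> set w = A \<Longrightarrow> f w = g w) \<Longrightarrow> \<mu> f = \<mu> g"
    "\<And>D h. \<not> A \<subseteq> D \<Longrightarrow> \<mu> (\<lambda>w. h (restriction w D)) = 0"
    using assms(1) unfolding restriction_annihilator_def by blast+
  have \<nu>: "\<And>f g. \<nu> (\<lambda>w. f w + g w) = \<nu> f + \<nu> g"
    "\<And>f g. (\<And>w. distinct w \<Longrightarrow> set w = B \<Longrightarrow> f w = g w) \<Longrightarrow> \<nu> f = \<nu> g"
    "\<And>D h. \<not> B \<subseteq> D \<Longrightarrow> \<nu> (\<lambda>w. h (restriction w D)) = 0"
    using assms(2) unfolding restriction_annihilator_def by blast+
  have z: "\<mu> (\<lambda>_. 0) = 0" using \<mu>(1)[of "\<lambda>_. 0" "\<lambda>_. 0"] by simp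
  have app: "restriction (u @ v) D = restriction u D @ restriction v D" for u v :: "'a list" and D
    by (simp add: restriction_def)
  show ?thesis
    unfolding restriction_annihilator_def
  proof (intro conjI allI impI)
    fix f g :: "'a list \<Rightarrow> real"
    assume fg: "\<forall>w. distinct w \<and> set w = A \<union> B \<longrightarrow> f w = g w"
    show "\<mu> (\<lambda>u. \<nu> (\<lambda>v. f (u @ v))) = \<mu> (\<lambda>u. \<nu> (\<lambda>v. g (u @ v)))"
      by (intro \<mu>(2) \<nu>(2)) (use fg assms(3) in auto)
  next
    fix D and h :: "'a list \<Rightarrow> real"
    assume D: "\<not> A \<union> B \<subseteq> D"
    \<comment> \<open>If all of \<open>B\<close> survives, \<open>A\<close> loses a letter and the
      outer factor kills the function of the shortened left word that the inner factor produces.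
      Otherwise the inner factor is zero for every left word.\<close>
    show "\<mu> (\<lambda>u. \<nu> (\<lambda>v. h (restriction (u @ v) D))) = 0"
    proof (cases "B \<subseteq> D")
      case True
      then have "\<not> A \<subseteq> D" using D by simp
      then show ?thesis
        using \<mu>(3)[of D "\<lambda>x. \<nu> (\<lambda>v. h (x @ restriction v D))"] by (simp add: app)
    next
      case False
      have "\<nu> (\<lambda>v. h (restriction u D @ restriction v D)) = 0" for u
        by (rule \<nu>(3)[OF False, of "\<lambda>x. h (restriction u D @ x)"])
      then show ?thesis using z by (simp only: app)
    qed
  next
    fix f g :: "'a list \<Rightarrow> real"
    have "\<nu> (\<lambda>v. f (u @ v) + g (u @ v)) = \<nu> (\<lambda>v. f (u @ v)) + \<nu> (\<lambda>v. g (u @ v))" for u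
      by (rule \<nu>(1))
    then show "\<mu> (\<lambda>u. \<nu> (\<lambda>v. f (u @ v) + g (u @ v)))
      = \<mu> (\<lambda>u. \<nu> (\<lambda>v. f (u @ v))) + \<mu> (\<lambda>u. \<nu> (\<lambda>v. g (u @ v)))"
      by (simp only: \<mu>(1)[of "\<lambda>u. \<nu> (\<lambda>v. f (u @ v))" "\<lambda>u. \<nu> (\<lambda>v. g (u @ v))"])
  qed
qed

section \<open>Linear relations on one level\<close>

text \<open>The last clause is what \<open>vertex_triple\<close> becomes when the coordinates on
  two-element subsets vanish.\<close>

definition level_relations :: "'a::finite set \<Rightarrow> ('a \<Rightarrow> 'a \<Rightarrow> real) \<Rightarrow> bool" where
  "level_relations B x \<longleftrightarrow>
    (\<forall>a b. x a b \<noteq> 0 \<longrightarrow> a \<in> B \<and> b \<in> B \<and> a \<noteq> b) \<and>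
    (\<Sum>a\<in>UNIV. \<Sum>b\<in>UNIV. x a b) = 0 \<and>
    (\<forall>w\<in>B. (\<Sum>a\<in>UNIV. x a w) = (- 1) ^ (card B - 1) * (\<Sum>b\<in>UNIV. x w b)) \<and>
    (\<forall>a b c. B = {a, b, c} \<and> distinct [a, b, c] \<longrightarrow> x a b + x a c + x c b = 0)"

text \<open>
  The conditions on \<open>c\<close> say that the function \<open>c (hd w) (last w)\<close> is killed by
  \<open>[a, b]\<close>, by \<open>[a, [\<dots>, [b, d]]]\<close>, and by \<open>[\<dots>, [a, b]] [d, e]\<close>, respectively.
\<close>

definition bracket_relations :: "'a set \<Rightarrow> ('a \<Rightarrow> 'a \<Rightarrow> real) \<Rightarrow> bool" where
  "bracket_relations B c \<longleftrightarrow>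
    (\<forall>a b. B = {a, b} \<and> a \<noteq> b \<longrightarrow> c a b = c b a) \<and>
    (\<forall>a b d. {a, b, d} \<subseteq> B \<and> distinct [a, b, d] \<longrightarrow>
      c a d - c a b = (- 1) ^ (card B - 3) * (c b a - c d a)) \<and>
    (\<forall>a b d e. {a, b, d, e} \<subseteq> B \<and> distinct [a, b, d, e] \<longrightarrow>
      c a e + c b d = c a d + c b e)"

lemma bracket_relationsI:
  assumes fin: "finite B"
    and ann: "\<And>\<mu>. restriction_annihilator B \<mu> \<Longrightarrow> \<mu> (\<lambda>w. c (hd w) (last w)) = 0"
  shows "bracket_relations B c"
  unfolding bracket_relations_def
proof (intro conjI allI impI; elim conjE)
  fix a b assume B: "B = {a, b}" "a \<noteq> b"
  have "restriction_annihilator B (bracket [a, b])"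
    using restriction_annihilator_bracket[of "[a, b]"] B by simp
  from ann[OF this] show "c a b = c b a" by simp
next
  fix a b d assume B: "{a, b, d} \<subseteq> B" and "distinct [a, b, d]"
  then have d: "a \<noteq> b" "a \<noteq> d" "b \<noteq> d" by auto
  obtain ys where ys: "set ys = B - {a, b, d}" "distinct ys"
    using finite_distinct_list[of "B - {a, b, d}"] fin by auto
  have len: "length ys = card B - 3"
    using distinct_card[OF ys(2)] ys(1) B d fin by (simp add: card_Diff_subset)
  let ?H = "\<lambda>w. c (hd w) (last w)"
  have "restriction_annihilator (set (a # ys @ [b, d])) (bracket (a # ys @ [b, d]))"
    by (rule restriction_annihilator_bracket) (use ys d in auto)
  moreover have "set (a # ys @ [b, d]) = B" using ys B by auto
  ultimately have "bracket (a # ys @ [b, d]) ?H = 0" by (simp add: ann)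
  \<comment> \<open>The outermost commutator puts \<open>a\<close> first or last, fixing one
    argument of \<open>c\<close>; the inner bracket then sees only a last or only a first
    letter.\<close>
  then have "bracket (ys @ [b, d]) (\<lambda>v. ?H (a # v)) = bracket (ys @ [b, d]) (\<lambda>v. ?H (v @ [a]))"
    by (simp add: bracket_Cons)
  moreover have "bracket (ys @ [b, d]) (\<lambda>v. ?H (a # v)) = bracket (ys @ [b, d]) (\<lambda>v. c a (last v))"
    by (rule bracket_cong_nonempty) auto
  moreover have "bracket (ys @ [b, d]) (\<lambda>v. ?H (v @ [a])) = bracket (ys @ [b, d]) (\<lambda>v. c (hd v) a)"
    by (rule bracket_cong_nonempty) auto
  ultimately show "c a d - c a b = (- 1) ^ (card B - 3) * (c b a - c d a)"
    using bracket_last[of ys b d "c a"] bracket_hd[of ys b d "\<lambda>u. c u a"] by (simp add: len)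
next
  fix a b d e assume B: "{a, b, d, e} \<subseteq> B" and "distinct [a, b, d, e]"
  then have d: "a \<noteq> b" "a \<noteq> d" "a \<noteq> e" "b \<noteq> d" "b \<noteq> e" "d \<noteq> e" by auto
  obtain ys where ys: "set ys = B - {a, b, d, e}" "distinct ys"
    using finite_distinct_list[of "B - {a, b, d, e}"] fin by auto
  let ?H = "\<lambda>w. c (hd w) (last w)"
  \<comment> \<open>First and last letters come from separate factors, so the product yields, up to
    sign, a mixed second difference of \<open>c\<close>.\<close>
  have "restriction_annihilator (set (ys @ [a, b]) \<union> set [d, e])
    (\<lambda>h. bracket (ys @ [a, b]) (\<lambda>u. bracket [d, e] (\<lambda>v. h (u @ v))))"
    by (intro restriction_annihilator_mult restriction_annihilator_bracket) (use ys d in auto)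
  moreover have "set (ys @ [a, b]) \<union> set [d, e] = B" using ys B by auto
  ultimately have "bracket (ys @ [a, b]) (\<lambda>u. bracket [d, e] (\<lambda>v. ?H (u @ v))) = 0"
    using ann by fastforce
  moreover have "bracket (ys @ [a, b]) (\<lambda>u. bracket [d, e] (\<lambda>v. ?H (u @ v)))
      = bracket (ys @ [a, b]) (\<lambda>u. c (hd u) e - c (hd u) d)"
    by (rule bracket_cong_nonempty) auto
  ultimately show "c a e + c b d = c a d + c b e"
    using bracket_hd[of ys a b "\<lambda>u. c u e - c u d"] by simp
qed

text \<open>The generic value \<open>k (k - 2)\<close> is corrected to 0, 1, 2 at
  \<open>k = 1, 2, 3\<close>; at \<open>k = 0\<close> it is already 0, so summing over all subsets
  is harmless.\<close>

definition level_count :: "nat \<Rightarrow> int" where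
  "level_count k = int k * (int k - 2) + of_bool (k = 1) + of_bool (k = 2) - of_bool (k = 3)"

text \<open>\<open>Q\<close> is a set of free coordinates on level \<open>B\<close>. The first
  clause serves the upper bound on the dimension (the entries in \<open>Q\<close> determine the
  matrix), the second the lower bound (no nonzero functional supported on \<open>Q\<close> is killed
  by the brackets).\<close>

definition determining_pairs :: "'a::finite set \<Rightarrow> ('a \<times> 'a) set \<Rightarrow> bool" where
  "determining_pairs B Q \<longleftrightarrow>
    (\<forall>x. level_relations B x \<longrightarrow> (\<forall>a b. (a, b) \<in> Q \<longrightarrow> x a b = 0) \<longrightarrow> (\<forall>a b. x a b = 0)) \<and>
    (\<forall>c. bracket_relations B c \<longrightarrow> (\<forall>a b. (a, b) \<notin> Q \<longrightarrow> c a b = 0) \<longrightarrow> (\<forall>a b. c a b = 0))"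

lemma determining_pairsI:
  assumes "\<And>x a b. level_relations B x \<Longrightarrow> (\<And>a b. (a, b) \<in> Q \<Longrightarrow> x a b = 0) \<Longrightarrow> x a b = 0"
    and "\<And>c a b. bracket_relations B c \<Longrightarrow> (\<And>a b. (a, b) \<notin> Q \<Longrightarrow> c a b = 0) \<Longrightarrow> c a b = 0"
  shows "determining_pairs B Q"
  unfolding determining_pairs_def by (intro conjI allI impI; rule assms; simp)

lemma ex_determining_pairs:
  fixes B :: "'a::finite set"
  assumes "card B \<ge> 2"
  shows "\<exists>Q. int (card Q) = level_count (card B) \<and> determining_pairs B Q"
proof -
  consider "card B = 2" | "card B = 3" | "card B \<ge> 4" using assms by linarith
  then show ?thesis
  proof cases
    case 1
    then obtain p z where B: "B = {p, z}" "p \<noteq> z" by (auto simp: card_2_iff)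
    show ?thesis
    proof (rule exI[of _ "{(p, z)}"], intro conjI determining_pairsI)
      show "int (card {(p, z)}) = level_count (card B)" by (simp add: 1 level_count_def)
    next
      fix x a b assume x: "level_relations B x" "\<And>a b. (a, b) \<in> {(p, z)} \<Longrightarrow> x a b = 0"
      have supp: "x a b = 0" if "(a, b) \<noteq> (z, p)" for a b
        using x that B unfolding level_relations_def by (cases "(a, b) = (p, z)") auto
      have "(\<Sum>a\<in>UNIV. \<Sum>b\<in>UNIV. x a b) = (\<Sum>a\<in>{z}. \<Sum>b\<in>UNIV. x a b)"
        by (rule sum.mono_neutral_right) (auto intro!: sum.neutral supp)
      also have "\<dots> = (\<Sum>a\<in>{z}. \<Sum>b\<in>{p}. x a b)"
        by (intro sum.cong sum.mono_neutral_right) (auto intro!: supp)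
      finally have "x z p = 0" using x(1) unfolding level_relations_def by simp
      then show "x a b = 0" using supp[of a b] by auto
    next
      fix c a b assume c: "bracket_relations B c" "\<And>a b. (a, b) \<notin> {(p, z)} \<Longrightarrow> c a b = 0"
      have "c p z = c z p" using c(1) B unfolding bracket_relations_def by blast
      then show "c a b = 0" using c(2)[of a b] c(2)[of z p] B by (cases "(a, b) = (p, z)") auto
    qed
  next
    case 2
    then obtain p q z where B: "B = {p, q, z}" and d: "p \<noteq> q" "p \<noteq> z" "q \<noteq> z"
      by (auto simp: card_3_iff)
    \<comment> \<open>Column \<open>z\<close> is free: the triangle relations for
      \<open>(p, z)\<close> and \<open>(q, z)\<close> give \<open>x p q\<close> and
      \<open>x q p\<close>, and the remaining two give row \<open>z\<close>.\<close>
    show ?thesis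
    proof (rule exI[of _ "{(p, z), (q, z)}"], intro conjI determining_pairsI)
      show "int (card {(p, z), (q, z)}) = level_count (card B)" using d by (simp add: 2 level_count_def)
    next
      fix x a b assume x: "level_relations B x" "\<And>a b. (a, b) \<in> {(p, z), (q, z)} \<Longrightarrow> x a b = 0"
      have supp: "x a b = 0" if "\<not> (a \<in> B \<and> b \<in> B \<and> a \<noteq> b)" for a b
        using x(1) that unfolding level_relations_def by blast
      have tri: "x a b + x a c + x c b = 0" if "{a, b, c} = B" "distinct [a, b, c]" for a b c
        using x(1) that unfolding level_relations_def by blast
      have z: "x p z = 0" "x q z = 0" using x(2) by auto
      have "x p z + x p q + x q z = 0" "x q z + x q p + x p z = 0"
        "x p q + x p z + x z q = 0" "x q p + x q z + x z p = 0"
        by (rule tri; use B d in auto)+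
      then have "x p q = 0" "x q p = 0" "x z q = 0" "x z p = 0" using z by auto
      then show "x a b = 0" using supp[of a b] z B by auto
    next
      fix c a b assume c: "bracket_relations B c" "\<And>a b. (a, b) \<notin> {(p, z), (q, z)} \<Longrightarrow> c a b = 0"
      have rel: "c a d - c a b = c b a - c d a" if "{a, b, d} = B" "distinct [a, b, d]" for a b d
        using c(1) that 2 unfolding bracket_relations_def
        by (metis cancel_comm_monoid_add_class.diff_cancel mult_1 order_refl power_0)
      have "c z q - c z p = c p z - c q z" "c p q - c p z = c z p - c q p"
        by (rule rel; use B d in auto)+
      moreover have "c z q = 0" "c z p = 0" "c p q = 0" "c q p = 0" using d by (auto intro: c(2))
      ultimately have "c p z = 0" "c q z = 0" by auto
      then show "c a b = 0" using c(2)[of a b] by (cases "(a, b) \<in> {(p, z), (q, z)}") auto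
    qed
  next
    case 3
    obtain z where z: "z \<in> B" using 3 by fastforce
    have avoid: "\<exists>v. v \<in> B - {z, s, t}" for s t
    proof -
      have "card (B - {z, s, t}) \<ge> card B - card {z, s, t}" by (rule diff_card_le_card_Diff) simp
      moreover have "card {z, s, t} \<le> 3" by (metis card_length length_Cons list.set list.size(3) numeral_3_eq_3)
      ultimately have "card (B - {z, s, t}) \<noteq> 0" using 3 by linarith
      then have "B - {z, s, t} \<noteq> {}" by (metis card.empty)
      then show ?thesis by blast
    qed
    obtain p where p: "p \<in> B - {z}" using avoid[of z z] by blast
    obtain q where q: "q \<in> B - {z} - {p}" using avoid[of p p] by blast
    \<comment> \<open>The omitted pairs are the star \<open>(z, _)\<close> and the edge \<open>(p, q)\<close>. With the edges
      \<open>{z, p}\<close> and \<open>{z, q}\<close> of the star it closes an odd cycle, so the column, row and total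
      sum relations determine the omitted entries for either sign.\<close>
    let ?Q = "(SIGMA a:B - {z}. B - {a}) - {(p, q)}"
    \<comment> \<open>There are \<open>k - 1\<close> rows other than \<open>z\<close> with
      \<open>k - 1\<close> off-diagonal entries each; dropping one leaves
      \<open>(k - 1)^2 - 1 = k (k - 2)\<close>.\<close>
    have "card (SIGMA a:B - {z}. B - {a}) = (card B - 1) * (card B - 1)"
      using z by (simp add: card_Diff_singleton)
    then have "card ?Q = (card B - 1) * (card B - 1) - 1"
      using p q by (subst card_Diff_singleton) auto
    then have card: "int (card ?Q) = level_count (card B)"
    proof -
      obtain m where m: "card B = Suc (Suc m)" using 3 by (metis add_2_eq_Suc le_Suc_ex numeral_Bit0 add.assoc)
      show ?thesis using 3 \<open>card ?Q = _\<close> unfolding m level_count_def by (simp add: algebra_simps)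
    qed
    show ?thesis
    proof (rule exI[of _ ?Q], intro conjI determining_pairsI)
      show "int (card ?Q) = level_count (card B)" by (rule card)
    next
      fix x a b assume x: "level_relations B x" "\<And>a b. (a, b) \<in> ?Q \<Longrightarrow> x a b = 0"
      have supp: "x a b = 0" if "a \<noteq> z" "(a, b) \<noteq> (p, q)" for a b
        using x that unfolding level_relations_def by blast
      have zz: "x a b = 0" if "\<not> (a \<in> B \<and> b \<in> B \<and> a \<noteq> b)" for a b
        using x(1) that unfolding level_relations_def by blast
      have cr: "(\<Sum>a\<in>UNIV. x a w) = (- 1) ^ (card B - 1) * (\<Sum>b\<in>UNIV. x w b)" if "w \<in> B" for w
        using x(1) that unfolding level_relations_def by blast
      \<comment> \<open>Column \<open>z\<close> contains no omitted entry, so its sum, and with it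
        the sum of row \<open>z\<close>, is zero. The total sum then isolates
        \<open>x p q\<close>.\<close>
      have "(\<Sum>a\<in>UNIV. x a z) = 0"
      proof (rule sum.neutral, rule ballI)
        fix a show "x a z = 0" using supp[of a z] zz[of z z] q by (cases "a = z") auto
      qed
      then have rz: "(\<Sum>b\<in>UNIV. x z b) = 0" using cr[OF z] by simp
      have "(\<Sum>a\<in>UNIV. \<Sum>b\<in>UNIV. x a b) = (\<Sum>a\<in>{z, p}. \<Sum>b\<in>UNIV. x a b)"
        by (rule sum.mono_neutral_right) (auto intro!: sum.neutral supp)
      also have "\<dots> = (\<Sum>b\<in>UNIV. x p b)" using p rz by auto
      also have "\<dots> = (\<Sum>b\<in>{q}. x p b)"
        by (rule sum.mono_neutral_right) (use p supp in auto)
      finally have pq: "x p q = 0" using x(1) unfolding level_relations_def by simp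
      then have supp': "x a b = 0" if "a \<noteq> z" for a b using supp[OF that, of b] by auto
      \<comment> \<open>Row \<open>w\<close> is now zero and column \<open>w\<close> has
        \<open>x z w\<close> as its only possible entry.\<close>
      have "x z w = 0" for w
      proof (cases "w \<in> B \<and> w \<noteq> z")
        case True
        have "(\<Sum>a\<in>UNIV. x a w) = (\<Sum>a\<in>{z}. x a w)"
          by (rule sum.mono_neutral_right) (use supp' in auto)
        then show ?thesis using cr[of w] True supp'[of w] by simp
      qed (use zz in auto)
      then show "x a b = 0" using supp'[of a b] by auto
    next
      fix c a b assume c: "bracket_relations B c" "\<And>a b. (a, b) \<notin> ?Q \<Longrightarrow> c a b = 0"
      have r1: "c a d - c a b = (- 1) ^ (card B - 3) * (c b a - c d a)"
        if "a \<in> B" "b \<in> B" "d \<in> B" "a \<noteq> b" "a \<noteq> d" "b \<noteq> d" for a b d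
      proof -
        have "{a, b, d} \<subseteq> B \<and> distinct [a, b, d]" using that by auto
        then show ?thesis using c(1) unfolding bracket_relations_def by blast
      qed
      have r2: "c a e + c b d = c a d + c b e"
        if "a \<in> B" "b \<in> B" "d \<in> B" "e \<in> B" "a \<noteq> b" "a \<noteq> d" "a \<noteq> e" "b \<noteq> d" "b \<noteq> e" "d \<noteq> e" for a b d e
      proof -
        have "{a, b, d, e} \<subseteq> B \<and> distinct [a, b, d, e]" using that by auto
        then show ?thesis using c(1) unfolding bracket_relations_def by blast
      qed
      have z0: "c z w = 0" for w by (rule c(2)) auto
      have pq0: "c p q = 0" by (rule c(2)) auto
      let ?B = "B - {z}"
      \<comment> \<open>Putting the vanishing row \<open>z\<close> into the four-letter relation
        makes each row constant off column \<open>z\<close>; the left side of the three-letter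
        relation then vanishes, which makes the columns constant as well.\<close>
      have row: "c b d = c b e" if "b \<in> ?B" "d \<in> ?B" "e \<in> ?B" "b \<noteq> d" "b \<noteq> e" for b d e
        using r2[of z b d e] that z z0 by (cases "d = e") auto
      have rows: "c b a = c d a" if "b \<in> ?B" "d \<in> ?B" "a \<in> ?B" "a \<noteq> b" "a \<noteq> d" for a b d
        using r1[of a b d] row[of a b d] that by (cases "b = d") auto
      have inner: "c b d = 0" if bd: "b \<in> ?B" "d \<in> ?B" "b \<noteq> d" for b d
      proof -
        \<comment> \<open>The detour through column \<open>v\<close> allows the move from row
          \<open>b\<close> to row \<open>p\<close> without meeting the diagonal.\<close>
        obtain v where v: "v \<in> B - {z, b, p}" using avoid by blast
        have "c b d = c b v" using row[of b d v] that v by auto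
        also have "\<dots> = c p v" using rows[of b p v] that v p by auto
        also have "\<dots> = c p q" using row[of p v q] v p q by auto
        finally show ?thesis using pq0 by simp
      qed
      have "c b z = 0" if b: "b \<in> ?B" for b
      proof -
        obtain v where v: "v \<in> B - {z, b, b}" using avoid by blast
        show ?thesis using r1[of b z v] inner[of b v] inner[of v b] z0 z b v by auto
      qed
      then show "c a b = 0"
        using z0 inner[of a b] c(2)[of a b] by (cases "(a, b) \<in> ?Q"; cases "b = z") auto
    qed
  qed
qed

section \<open>Sums over subsets\<close>

lemma sum_Pow_insert:
  assumes "finite A" "x \<notin> A"
  shows "(\<Sum>C\<in>Pow (insert x A). f (card C)) = (\<Sum>C\<in>Pow A. f (card C) + f (Suc (card C)))"
proof -
  have i: "inj_on (insert x) (Pow A)" using assms(2) by (auto simp: inj_on_def)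
  have "(\<Sum>C\<in>insert x ` Pow A. f (card C)) = (\<Sum>C\<in>Pow A. f (Suc (card C)))"
    unfolding sum.reindex[OF i] o_def
  proof (rule sum.cong)
    fix C assume "C \<in> Pow A"
    then have "x \<notin> C" "finite C" using assms finite_subset by auto
    then show "f (card (insert x C)) = f (Suc (card C))" by simp
  qed simp
  moreover have "Pow A \<inter> insert x ` Pow A = {}" using assms(2) by auto
  ultimately show ?thesis
    using assms(1) by (simp add: Pow_insert sum.union_disjoint sum.distrib)
qed

lemma sum_Pow_uminus_one_power:
  assumes "finite A"
  shows "(\<Sum>C\<in>Pow A. (- 1) ^ card C) = (of_bool (A = {}) :: real)"
  using assms
proof (induction A rule: finite_induct)
  case (insert x A)
  then show ?case using sum_Pow_insert[of A x "\<lambda>k. (- 1 :: real) ^ k"] by simp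
qed simp

lemma sum_Pow_level_count:
  assumes "finite A" "card A = n" "n \<ge> 2"
  shows "(\<Sum>B\<in>Pow A. level_count (card B)) =
    int n * (int n - 3) * 2 ^ (n - 2) + int (n choose 2) - int (n choose 3) + int n"
proof -
  \<comment> \<open>The first two moments of the subset size, cleared of denominators so that no
    truncated exponent enters the induction. They are proved together because the step for the
    second uses the first.\<close>
  have "4 * (\<Sum>B\<in>Pow A. (int (card B))\<^sup>2) = int (card A) * (int (card A) + 1) * 2 ^ card A \<and>
      2 * (\<Sum>B\<in>Pow A. int (card B)) = int (card A) * 2 ^ card A"
    using assms(1)
  proof (induction A rule: finite_induct)
    case (insert x A)
    let ?S1 = "\<Sum>B\<in>Pow A. int (card B)" and ?S2 = "\<Sum>B\<in>Pow A. (int (card B))\<^sup>2"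
    have "(\<Sum>B\<in>Pow (insert x A). int (card B)) = 2 * ?S1 + 2 ^ card A"
      using sum_Pow_insert[OF insert(1,2), of int] insert(1)
      by (simp add: sum.distrib card_Pow sum_distrib_left)
    moreover have "(\<Sum>B\<in>Pow (insert x A). (int (card B))\<^sup>2) = 2 * ?S2 + 2 * ?S1 + 2 ^ card A"
      using sum_Pow_insert[OF insert(1,2), of "\<lambda>k. (int k)\<^sup>2"] insert(1)
      by (simp add: power2_eq_square algebra_simps sum.distrib card_Pow sum_distrib_left)
    ultimately show ?case
      using insert by (simp add: algebra_simps)
  qed simp
  then have "4 * (\<Sum>B\<in>Pow A. int (card B) * (int (card B) - 2)) = int n * (int n - 3) * 2 ^ n"
    using assms(2) by (simp add: algebra_simps power2_eq_square sum_subtractf flip: sum_distrib_right)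
  moreover have "(2::int) ^ n = 4 * 2 ^ (n - 2)"
    using assms(3) by (metis power_add le_add_diff_inverse power2_eq_square numeral_times_numeral mult_2 numeral_Bit0)
  ultimately have "(\<Sum>B\<in>Pow A. int (card B) * (int (card B) - 2)) = int n * (int n - 3) * 2 ^ (n - 2)"
    using assms(2) by simp
  \<comment> \<open>For \<open>k = 1, 2, 3\<close> these are the binomial terms of the closed
    formula.\<close>
  moreover have "(\<Sum>B\<in>Pow A. of_bool (card B = k)) = int (n choose k)" for k
  proof -
    have "(\<Sum>B\<in>Pow A. of_bool (card B = k)) = int (card {B \<in> Pow A. card B = k})"
      using assms(1) by (simp add: Int_def)
    then show ?thesis using n_subsets[OF assms(1), of k] assms(2) by simp
  qed
  ultimately show ?thesis
    unfolding level_count_def by (simp add: sum.distrib sum_subtractf del: sum_of_bool_eq)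
qed

section \<open>Relations between the vertices\<close>

lemma rankingsD:
  assumes "\<pi> \<in> rankings"
  shows "distinct \<pi>" "set \<pi> = UNIV"
  using assms by (auto simp: rankings_def)

lemma best_worst_mem:
  assumes "\<pi> \<in> rankings" "2 \<le> card B"
  shows "best \<pi> B \<in> B" "worst \<pi> B \<in> B" "best \<pi> B \<noteq> worst \<pi> B"
proof -
  have d: "distinct (restriction \<pi> B)" and s: "set (restriction \<pi> B) = B"
    using rankingsD[OF assms(1)] by (auto simp: restriction_def)
  then have "length (restriction \<pi> B) \<ge> 2" using assms(2) distinct_card by metis
  then obtain x y zs where r: "restriction \<pi> B = x # y # zs"
    by (metis Suc_le_length_iff numeral_2_eq_2)
  have "last (y # zs) \<in> set (y # zs)" by (rule last_in_set) simp
  then show "best \<pi> B \<in> B" "worst \<pi> B \<in> B" "best \<pi> B \<noteq> worst \<pi> B"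
    using d s unfolding best_def worst_def r by auto
qed

lemma vertex_nth:
  assumes "\<pi> \<in> rankings"
  shows "vertex \<pi> $ (a, b, B) = of_bool (2 \<le> card B \<and> best \<pi> B = a \<and> worst \<pi> B = b)"
  using best_worst_mem[OF assms, of B] by (auto simp: vertex_def Theta_def)

lemma sum_vertex_best:
  assumes "\<pi> \<in> rankings" "2 \<le> card B"
  shows "(\<Sum>b\<in>UNIV. vertex \<pi> $ (a, b, B)) = of_bool (best \<pi> B = a)"
  by (cases "best \<pi> B = a") (use assms in \<open>auto simp: vertex_nth of_bool_def\<close>)

lemma sum_vertex_worst:
  assumes "\<pi> \<in> rankings" "2 \<le> card B"
  shows "(\<Sum>a\<in>UNIV. vertex \<pi> $ (a, b, B)) = of_bool (worst \<pi> B = b)"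
  by (cases "worst \<pi> B = b") (use assms in \<open>auto simp: vertex_nth of_bool_def\<close>)

text \<open>Since \<open>w\<close> is best in \<open>insert w C\<close> exactly when all of
  \<open>C\<close> follows \<open>w\<close>, the alternating sum runs over the subsets of the part
  of \<open>D\<close> after \<open>w\<close>. It is 1 if that part is empty, that is, if
  \<open>w\<close> is worst, and 0 otherwise.\<close>

lemma worst_eq_sum_best:
  fixes \<pi> :: "'a::finite list"
  assumes "\<pi> \<in> rankings" "w \<notin> D"
  shows "of_bool (worst \<pi> (insert w D) = w) =
    (\<Sum>C\<in>Pow D. (- 1) ^ card C * of_bool (best \<pi> (insert w C) = w) :: real)"
proof -
  have "w \<in> set \<pi>" using rankingsD[OF assms(1)] by simp
  then obtain us vs where \<pi>: "\<pi> = us @ w # vs" by (meson split_list)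
  have w: "w \<notin> set us" "w \<notin> set vs" "set us \<inter> set vs = {}" "set us \<union> set vs \<union> {w} = UNIV"
    using rankingsD[OF assms(1)] unfolding \<pi> by auto
  have best: "best \<pi> (insert w C) = w \<longleftrightarrow> C \<inter> set us = {}" for C
  proof (cases "filter (\<lambda>x. x \<in> insert w C) us")
    case Nil
    then show ?thesis
      using w(1) by (auto simp: best_def restriction_def \<pi> filter_empty_conv)
  next
    case (Cons u l)
    then have "u \<in> set (filter (\<lambda>x. x \<in> insert w C) us)" by simp
    then show ?thesis
      using Cons w(1) by (auto simp: best_def restriction_def \<pi>)
  qed
  have worst: "worst \<pi> (insert w C) = w \<longleftrightarrow> C \<inter> set vs = {}" for C
  proof (cases "filter (\<lambda>x. x \<in> insert w C) vs" rule: rev_cases)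
    case Nil
    then show ?thesis
      using w(2) by (auto simp: worst_def restriction_def \<pi> filter_empty_conv)
  next
    case (snoc l u)
    then have "u \<in> set (filter (\<lambda>x. x \<in> insert w C) vs)" by simp
    then show ?thesis
      using snoc w(2) by (auto simp: worst_def restriction_def \<pi>)
  qed
  have "(\<Sum>C\<in>Pow D. (- 1) ^ card C * of_bool (best \<pi> (insert w C) = w) :: real)
      = (\<Sum>C\<in>Pow (D - set us). (- 1) ^ card C)"
    unfolding best by (rule sum.mono_neutral_cong_right) auto
  also have "\<dots> = of_bool (D - set us = {})" by (rule sum_Pow_uminus_one_power) simp
  also have "D - set us = {} \<longleftrightarrow> worst \<pi> (insert w D) = w"
    unfolding worst using w assms(2) by auto
  finally show ?thesis by simp
qed

text \<open>The event that \<open>a\<close> precedes \<open>b\<close> splits by the position of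
  \<open>c\<close>: between them, after both, or before both.\<close>

lemma vertex_triple:
  assumes "\<pi> \<in> rankings" "distinct [a, b, c]"
  shows "vertex \<pi> $ (a, b, {a, b}) =
    vertex \<pi> $ (a, b, {a, b, c}) + vertex \<pi> $ (a, c, {a, b, c}) + vertex \<pi> $ (c, b, {a, b, c})"
proof -
  have d: "a \<noteq> b" "a \<noteq> c" "b \<noteq> c" using assms(2) by auto
  let ?l = "restriction \<pi> {a, b, c}"
  have l: "distinct ?l" "set ?l = {a, b, c}"
    using rankingsD[OF assms(1)] by (auto simp: restriction_def)
  then have "length ?l = 3" using d distinct_card[OF l(1)] by simp
  then obtain x y z where xyz: "?l = [x, y, z]"
    by (auto simp: numeral_3_eq_3 length_Suc_conv)
  have "restriction \<pi> {a, b} = restriction ?l {a, b}"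
    by (auto simp: restriction_def intro!: filter_cong)
  moreover have "x \<in> {a, b, c}" "y \<in> {a, b, c}" "z \<in> {a, b, c}" "x \<noteq> y" "x \<noteq> z" "y \<noteq> z"
    using l unfolding xyz by auto
  ultimately show ?thesis
    using d unfolding vertex_nth[OF assms(1)] best_def worst_def xyz
    by (auto simp: restriction_def)
qed

definition direction_space :: "'a::finite list \<Rightarrow> (real ^ ('a \<times> 'a \<times> 'a set)) set" where
  "direction_space \<pi>0 = span ((+) (- vertex \<pi>0) ` vertex ` rankings)"

text \<open>Differences of vertices cancel the constant \<open>k\<close>, so every affine identity
  between vertex coordinates becomes a homogeneous relation on directions.\<close>

lemma direction_space_eq_0:
  fixes L :: "real ^ ('a::finite \<times> 'a \<times> 'a set) \<Rightarrow> real"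
  assumes "linear L" "\<And>\<pi>. \<pi> \<in> rankings \<Longrightarrow> L (vertex \<pi>) = k" "\<pi>0 \<in> rankings" "x \<in> direction_space \<pi>0"
  shows "L x = 0"
  by (rule linear_eq_0_on_span[OF assms(1) _ assms(4)[unfolded direction_space_def]])
    (use assms(2,3) in \<open>auto simp: linear_diff[OF assms(1)]\<close>)

lemma level_relations_direction_space:
  fixes B :: "'a::finite set"
  assumes \<pi>0: "\<pi>0 \<in> rankings" and x: "x \<in> direction_space \<pi>0" and B: "2 \<le> card B"
    and lower: "\<And>a b C. C \<subset> B \<Longrightarrow> x $ (a, b, C) = 0"
  shows "level_relations B (\<lambda>a b. x $ (a, b, B))"
  unfolding level_relations_def
proof (intro conjI allI impI ballI; (elim conjE)?)
  fix a b assume nz: "x $ (a, b, B) \<noteq> 0"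
  have "x $ (a, b, B) = 0" if "\<not> (a \<in> B \<and> b \<in> B \<and> a \<noteq> b)"
    by (rule direction_space_eq_0[where k = 0, OF _ _ \<pi>0 x])
      (use that B in \<open>auto simp: vertex_nth best_worst_mem intro!: linearI\<close>)
  then show "a \<in> B" "b \<in> B" "a \<noteq> b" using nz by blast+
next
  \<comment> \<open>The constant is 1: each ranking has exactly one best-worst pair in
    \<open>B\<close>.\<close>
  show "(\<Sum>a\<in>UNIV. \<Sum>b\<in>UNIV. x $ (a, b, B)) = 0"
    by (rule direction_space_eq_0[where k = 1, OF _ _ \<pi>0 x])
      (use B in \<open>auto simp: sum_vertex_best sum.distrib sum_distrib_left of_bool_def intro!: linearI\<close>)
next
  fix w assume w: "w \<in> B"
  have insB: "insert w (B - {w}) = B" using w by blast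
  \<comment> \<open>The empty \<open>C\<close> is left out because the singleton level
    \<open>{w}\<close> carries no coordinates. Its inclusion-exclusion term is always 1 and becomes
    the constant \<open>k = 1\<close>.\<close>
  let ?R = "\<lambda>x :: real ^ ('a \<times> 'a \<times> 'a set).
    \<Sum>C\<in>Pow (B - {w}) - {{}}. (- 1) ^ card C * (\<Sum>b\<in>UNIV. x $ (w, b, insert w C))"
  have "(\<Sum>a\<in>UNIV. x $ (a, w, B)) - ?R x = 0"
  proof (rule direction_space_eq_0[where k = 1, OF _ _ \<pi>0 x])
    show "linear (\<lambda>x :: real ^ ('a \<times> 'a \<times> 'a set). (\<Sum>a\<in>UNIV. x $ (a, w, B)) - ?R x)"
      by (rule linearI) (simp_all add: sum.distrib sum_distrib_left algebra_simps)
  next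
    fix \<pi> :: "'a list" assume \<pi>: "\<pi> \<in> rankings"
    have R: "?R (vertex \<pi>) = (\<Sum>C\<in>Pow (B - {w}) - {{}}. (- 1) ^ card C * of_bool (best \<pi> (insert w C) = w))"
    proof (intro sum.cong refl arg_cong2[where f = "(*)"] sum_vertex_best[OF \<pi>])
      fix C assume C: "C \<in> Pow (B - {w}) - {{}}"
      then have "w \<notin> C" "card C > 0" by (auto simp: card_gt_0_iff)
      then show "2 \<le> card (insert w C)" by simp
    qed
    have "best \<pi> {w} = w"
    proof -
      have "set (restriction \<pi> {w}) = {w}" using rankingsD[OF \<pi>] by (auto simp: restriction_def)
      then show ?thesis unfolding best_def by (metis hd_in_set list.set(1) singletonD insert_not_empty)
    qed
    then have "(\<Sum>C\<in>Pow (B - {w}). (- 1) ^ card C * of_bool (best \<pi> (insert w C) = w)) = 1 + ?R (vertex \<pi>)"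
      unfolding R by (subst sum.remove[of _ "{}"]) auto
    then show "(\<Sum>a\<in>UNIV. vertex \<pi> $ (a, w, B)) - ?R (vertex \<pi>) = 1"
      using worst_eq_sum_best[OF \<pi>, of w "B - {w}"] sum_vertex_worst[OF \<pi> B, of w] insB by simp
  qed
  \<comment> \<open>Every other \<open>C\<close> gives a proper subset \<open>insert w C\<close> of
    \<open>B\<close>, where \<open>x\<close> vanishes; the surviving term has sign exponent
    \<open>card B - 1\<close>.\<close>
  moreover have "?R x = (\<Sum>C\<in>{B - {w}}. (- 1) ^ card C * (\<Sum>b\<in>UNIV. x $ (w, b, insert w C)))"
  proof (rule sum.mono_neutral_right)
    have "card (B - {w}) \<noteq> 0" using w B by simp
    then show "{B - {w}} \<subseteq> Pow (B - {w}) - {{}}" by auto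
    show "\<forall>C\<in>Pow (B - {w}) - {{}} - {B - {w}}. (- 1) ^ card C * (\<Sum>b\<in>UNIV. x $ (w, b, insert w C)) = 0"
    proof
      fix C assume "C \<in> Pow (B - {w}) - {{}} - {B - {w}}"
      then have "insert w C \<subset> B" using w by auto
      then show "(- 1) ^ card C * (\<Sum>b\<in>UNIV. x $ (w, b, insert w C)) = 0" using lower by simp
    qed
  qed simp
  ultimately show "(\<Sum>a\<in>UNIV. x $ (a, w, B)) = (- 1) ^ (card B - 1) * (\<Sum>b\<in>UNIV. x $ (w, b, B))"
    using insB w by (simp add: card_Diff_singleton)
next
  fix a b c assume abc: "B = {a, b, c}" "distinct [a, b, c]"
  have "x $ (a, b, B) + x $ (a, c, B) + x $ (c, b, B) - x $ (a, b, {a, b}) = 0"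
    by (rule direction_space_eq_0[where k = 0, OF _ _ \<pi>0 x])
      (use vertex_triple[OF _ abc(2)] abc(1) in \<open>auto simp: algebra_simps intro!: linearI\<close>)
  moreover have "x $ (a, b, {a, b}) = 0" by (rule lower) (use abc in auto)
  ultimately show "x $ (a, b, B) + x $ (a, c, B) + x $ (c, b, B) = 0" by simp
qed

section \<open>Functionals that are constant on the vertices\<close>

lemma inner_vertex:
  fixes y :: "real ^ ('a::finite \<times> 'a \<times> 'a set)"
  assumes "\<pi> \<in> rankings"
  shows "y \<bullet> vertex \<pi> = (\<Sum>B | 2 \<le> card B. y $ (best \<pi> B, worst \<pi> B, B))"
proof -
  let ?f = "\<lambda>B. (best \<pi> B, worst \<pi> B, B)"
  have "y \<bullet> vertex \<pi> = (\<Sum>t\<in>UNIV. y $ t * vertex \<pi> $ t)" by (simp add: inner_vec_def)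
  also have "\<dots> = (\<Sum>t\<in>?f ` {B. 2 \<le> card B}. y $ t)"
    by (rule sum.mono_neutral_cong_right) (auto simp: vertex_nth[OF assms] image_iff)
  also have "\<dots> = (\<Sum>B | 2 \<le> card B. y $ ?f B)"
    by (subst sum.reindex) (auto simp: inj_on_def)
  finally show ?thesis .
qed

text \<open>
  Append to the words over \<open>B\<close> a fixed word over the complement: every level other than \<open>B\<close>
  then either has zero coefficients or sees only a restriction to a set not containing \<open>B\<close>.
\<close>

lemma annihilator_top_level:
  fixes y :: "real ^ ('a::finite \<times> 'a \<times> 'a set)"
  assumes const: "\<And>\<pi>. \<pi> \<in> rankings \<Longrightarrow> y \<bullet> vertex \<pi> = k"
    and B: "2 \<le> card B" and upper: "\<And>a b C. B \<subset> C \<Longrightarrow> y $ (a, b, C) = 0"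
    and \<mu>: "restriction_annihilator B \<mu>"
  shows "\<mu> (\<lambda>w. y $ (hd w, last w, B)) = 0"
proof -
  have add: "\<And>f g. \<mu> (\<lambda>w. f w + g w) = \<mu> f + \<mu> g"
    and cong: "\<And>f g. (\<And>w. distinct w \<Longrightarrow> set w = B \<Longrightarrow> f w = g w) \<Longrightarrow> \<mu> f = \<mu> g"
    and ann: "\<And>D h. \<not> B \<subseteq> D \<Longrightarrow> \<mu> (\<lambda>w. h (restriction w D)) = 0"
    using \<mu> unfolding restriction_annihilator_def by blast+
  have zero: "\<mu> (\<lambda>_. 0) = 0" using add[of "\<lambda>_. 0" "\<lambda>_. 0"] by simp
  have sum: "\<mu> (\<lambda>w. \<Sum>C\<in>F. f C w) = (\<Sum>C\<in>F. \<mu> (f C))" if "finite F" for F and f :: "'a set \<Rightarrow> 'a list \<Rightarrow> real"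
    using that by (induction F rule: finite_induct) (simp_all add: zero add)
  have ne: "B \<noteq> {}" using B by auto
  obtain r where r: "set r = - B" "distinct r" using finite_distinct_list[of "- B"] by auto
  define G where "G C u = y $ (hd (u @ restriction r C), last (u @ restriction r C), C)" for C u
  have "k = (\<Sum>C | 2 \<le> card C. G C (restriction w C))" if "distinct w" "set w = B" for w
  proof -
    have "w @ r \<in> rankings" using that r by (auto simp: rankings_def)
    then show ?thesis
      using const[of "w @ r"] inner_vertex[of "w @ r" y]
      by (simp add: G_def best_def worst_def restriction_def)
  qed
  then have "\<mu> (\<lambda>_. k) = \<mu> (\<lambda>w. \<Sum>C | 2 \<le> card C. G C (restriction w C))" by (intro cong)
  \<comment> \<open>A constant factors through the restriction to the empty set, so it is
    annihilated.\<close>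
  moreover have "\<mu> (\<lambda>_. k) = 0" using ann[of "{}" "\<lambda>_. k"] ne by simp
  ultimately have "0 = (\<Sum>C | 2 \<le> card C. \<mu> (\<lambda>w. G C (restriction w C)))" by (simp add: sum)
  also have "\<dots> = (\<Sum>C\<in>{B}. \<mu> (\<lambda>w. G C (restriction w C)))"
  proof (rule sum.mono_neutral_right)
    show "\<forall>C\<in>{C. 2 \<le> card C} - {B}. \<mu> (\<lambda>w. G C (restriction w C)) = 0"
    proof
      fix C assume "C \<in> {C. 2 \<le> card C} - {B}"
      then consider "B \<subset> C" | "\<not> B \<subseteq> C" by auto
      then show "\<mu> (\<lambda>w. G C (restriction w C)) = 0"
      proof cases
        case 1
        then show ?thesis using zero by (simp add: G_def upper)
      next
        case 2
        then show ?thesis by (rule ann)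
      qed
    qed
  qed (use B in auto)
  also have "\<dots> = \<mu> (\<lambda>w. y $ (hd w, last w, B))"
  proof (simp, rule cong)
    fix w assume "distinct w" "set w = B"
    moreover have "restriction r B = []" using r by (auto simp: restriction_def filter_empty_conv)
    ultimately show "G B (restriction w B) = y $ (hd w, last w, B)"
      by (simp add: G_def) (simp add: restriction_def)
  qed
  finally show ?thesis by simp
qed

section \<open>Dimension count by projection onto the free coordinates\<close>

theorem theorem1p1:
  fixes n :: nat
  assumes "CARD('n::finite) = n" and "n \<ge> 2"
  shows "aff_dim (BW :: (real ^ ('n \<times> 'n \<times> 'n set)) set) =
    int n * (int n - 3) * 2 ^ (n - 2) + int (n choose 2) - int (n choose 3) + int n"
proof -
  obtain \<pi>0 :: "'n list" where \<pi>0: "\<pi>0 \<in> rankings"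
    using finite_distinct_list[of "UNIV :: 'n set"] by (auto simp: rankings_def)
  let ?S = "(+) (- vertex \<pi>0) ` vertex ` rankings"
  obtain Q :: "'n set \<Rightarrow> ('n \<times> 'n) set"
    where cardQ: "\<And>B. 2 \<le> card B \<Longrightarrow> int (card (Q B)) = level_count (card B)"
      and Q: "\<And>B. 2 \<le> card B \<Longrightarrow> determining_pairs B (Q B)"
    using ex_determining_pairs by metis
  define T where "T = {(a, b, B) | a b B. 2 \<le> card B \<and> (a, b) \<in> Q B}"
  have "T = (\<lambda>(B, a, b). (a, b, B)) ` (SIGMA B:{B. 2 \<le> card B}. Q B)"
    by (force simp: T_def)
  then have "card T = card (SIGMA B:{B. 2 \<le> card B}. Q B)"
    by (simp add: card_image inj_on_def split_def prod_eq_iff)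
  then have "int (card T) = (\<Sum>B | 2 \<le> card B. int (card (Q B)))"
    by (simp add: of_nat_sum)
  also have "\<dots> = (\<Sum>B | 2 \<le> card (B :: 'n set). level_count (card B))"
    by (rule sum.cong) (auto simp: cardQ)
  also have "\<dots> = (\<Sum>B\<in>Pow (UNIV :: 'n set). level_count (card B))"
  proof (rule sum.mono_neutral_left)
    show "\<forall>B\<in>Pow (UNIV :: 'n set) - {B. 2 \<le> card B}. level_count (card B) = 0"
    proof
      fix B :: "'n set" assume "B \<in> Pow UNIV - {B. 2 \<le> card B}"
      then have "card B < 2" by simp
      then have "card B = 0 \<or> card B = 1" by linarith
      then show "level_count (card B) = 0" by (auto simp: level_count_def)
    qed
  qed auto
  finally have cardT: "int (card T) =
      int n * (int n - 3) * 2 ^ (n - 2) + int (n choose 2) - int (n choose 3) + int n"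
    using sum_Pow_level_count[of "UNIV :: 'n set" n] assms by simp
  \<comment> \<open>\<open>P\<close> projects onto the free coordinates \<open>T\<close>. It is
    injective on the direction space and maps it onto all vectors supported on \<open>T\<close>, so
    the dimension is \<open>card T\<close>.\<close>
  define P :: "real ^ ('n \<times> 'n \<times> 'n set) \<Rightarrow> real ^ ('n \<times> 'n \<times> 'n set)"
    where "P x = (\<chi> t. if t \<in> T then x $ t else 0)" for x
  have linP: "linear P" by (rule linearI) (auto simp: P_def vec_eq_iff)
  have "inj_on P (span ?S)"
  proof (subst linear_injective_on_subspace_0[OF linP subspace_span], intro ballI impI)
    fix x assume "x \<in> span ?S" and Px: "P x = 0"
    then have x: "x \<in> direction_space \<pi>0" by (simp add: direction_space_def)
    have xT: "x $ t = 0" if "t \<in> T" for t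
      using arg_cong[OF Px, of "\<lambda>y. y $ t"] that by (simp add: P_def)
    \<comment> \<open>Upward induction on the size of the level: once all smaller levels vanish, the
      level relations apply, and the zero entries on \<open>Q B\<close> force the rest.\<close>
    have "x $ (a, b, B) = 0" for a b B
    proof (induction "card B" arbitrary: a b B rule: less_induct)
      case less
      show ?case
      proof (cases "2 \<le> card B")
        case True
        have "level_relations B (\<lambda>a b. x $ (a, b, B))"
          by (rule level_relations_direction_space[OF \<pi>0 x True]) (rule less, rule psubset_card_mono, simp)
        moreover have "\<forall>a b. (a, b) \<in> Q B \<longrightarrow> x $ (a, b, B) = 0"
          using xT True by (auto simp: T_def)
        ultimately show ?thesis using Q[OF True] unfolding determining_pairs_def by blast
      next
        case False
        show ?thesis
          by (rule direction_space_eq_0[where k = 0, OF _ _ \<pi>0 x])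
            (use False in \<open>auto simp: vertex_nth intro!: linearI\<close>)
      qed
    qed
    then show "x = 0" by (auto simp: vec_eq_iff)
  qed
  then have dimP: "dim ?S = dim (P ` ?S)" using dim_image_eq[OF linP] by simp
  have "span (P ` ?S) = {x. \<forall>t. t \<notin> T \<longrightarrow> x $ t = 0}" (is "_ = ?E")
  proof -
    have subE: "subspace ?E" by (auto simp: subspace_def)
    then have spanE: "span ?E = ?E" by (rule span_eq_iff[THEN iffD2])
    have "span (P ` ?S) \<subseteq> ?E"
      by (rule span_minimal[OF _ subE]) (auto simp: P_def)
    \<comment> \<open>A proper inclusion would give a nonzero \<open>y\<close> supported on
      \<open>T\<close> and orthogonal to the image. Such a \<open>y\<close> satisfies
      \<open>y \<bullet> P z = y \<bullet> z\<close>, so it is constant on the vertices.\<close>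
    moreover have "\<not> span (P ` ?S) \<subset> ?E"
    proof
      assume "span (P ` ?S) \<subset> ?E"
      then have "span (P ` ?S) \<subset> span ?E" by (simp only: spanE)
      then obtain y where y: "y \<noteq> 0" "y \<in> span ?E"
          and orth: "\<And>z. z \<in> span (P ` ?S) \<Longrightarrow> orthogonal y z"
        using orthogonal_to_subspace_exists_gen by blast
      have yT: "y $ t = 0" if "t \<notin> T" for t using y(2) that unfolding spanE by blast
      have const: "y \<bullet> vertex \<pi> = y \<bullet> vertex \<pi>0" if "\<pi> \<in> rankings" for \<pi>
      proof -
        have "P (- vertex \<pi>0 + vertex \<pi>) \<in> span (P ` ?S)"
          by (intro span_base imageI that)
        then have "y \<bullet> P (- vertex \<pi>0 + vertex \<pi>) = 0"
          using orth by (simp only: orthogonal_def)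
        moreover have "y \<bullet> P z = y \<bullet> z" for z
          using yT by (auto simp: inner_vec_def P_def intro!: sum.cong)
        ultimately show ?thesis by (simp add: inner_diff_right)
      qed
      \<comment> \<open>Downward induction: when all levels strictly above \<open>B\<close> vanish,
        the annihilators of \<open>B\<close> see only level \<open>B\<close>.\<close>
      have "y $ (a, b, B) = 0" for a b B
      proof (induction "CARD('n) - card B" arbitrary: a b B rule: less_induct)
        case less
        show ?case
        proof (cases "2 \<le> card B")
          case True
          have upper: "y $ (a, b, C) = 0" if "B \<subset> C" for a b C
          proof (rule less)
            have "card B < card C" using that by (simp add: psubset_card_mono)
            moreover have "card C \<le> CARD('n)" by (simp add: card_mono)
            ultimately show "CARD('n) - card C < CARD('n) - card B" by linarith
          qed
          have "bracket_relations B (\<lambda>a b. y $ (a, b, B))"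
            by (rule bracket_relationsI, simp) (rule annihilator_top_level[OF const True upper])
          moreover have "\<forall>a b. (a, b) \<notin> Q B \<longrightarrow> y $ (a, b, B) = 0"
            by (auto intro!: yT simp: T_def)
          ultimately show ?thesis using Q[OF True] unfolding determining_pairs_def by blast
        qed (auto intro!: yT simp: T_def)
      qed
      then show False using y(1) by (auto simp: vec_eq_iff)
    qed
    ultimately show ?thesis by blast
  qed
  then have "dim (P ` ?S) = dim ?E" using dim_span[of "P ` ?S"] by (simp only:)
  also have "\<dots> = card T" unfolding dim_vec_eq[symmetric] by (rule dim_substandard_cart)
  finally have "dim (P ` ?S) = card T" .
  with dimP have "dim ?S = card T" by (simp only:)
  moreover have "aff_dim (BW :: (real ^ ('n \<times> 'n \<times> 'n set)) set) = int (dim ?S)"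
    unfolding BW_def aff_dim_convex_hull
    by (rule aff_dim_eq_dim) (intro hull_inc imageI \<pi>0)
  ultimately show ?thesis using cardT by (simp only:)
qed

end
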